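(* Let $\sigma\subseteq\tau$ be topologies on a set $X$, with $\tau$ $\pi$-semiregular. Let $\kappa$ be an infinite cardinal such that $\tau$ is $\kappa$-Baire, and let $1\leq\alpha\leq\kappa$ be an ordinal. Assume that $\tau$ has a neighborhood $\pi$-basis consisting of sets in $\bigcup_{\xi<\alpha}\mathbf{\Sigma}^{\kappa,0}_{1+\xi}$ with respect to $\sigma$. If $(\tau_\xi)_{\xi<\alpha}$ is a filtration from $\sigma$ to $\tau$, then each nonempty $\tau$-open set contains a nonempty $\big(\bigvee_{\xi<\alpha}\tau_\xi\big)$-open set.
   Context: All topologies are on a fixed set $X$; $\mathrm{int}_\tau$ denotes interior with respect to $\tau$. Filtration: for topologies $\sigma\subseteq\tau$ and an ordinal $\rho$, a transfinite sequence of topologies $(\tau_\xi)_{\xi<\rho}$ is a filtration from $\sigma$ to $\tau$ if $\sigma=\tau_0\subseteq\tau_1\subseteq\cdots\subseteq\tau_\xi\subseteq\cdots\subseteq\tau$ (increasing, starting at $\sigma$, all contained in $\tau$) and, for each $\alpha<\rho$, if $F$ is $\tau_\xi$-closed for some $\xi<\alpha$, then $\mathrm{int}_{\tau_\alpha}(F)=\mathrm{int}_\tau(F)$. Join: for a family $S$ of topologies, $\bigvee S$ is the smallest topology containing each topology in $S$. Neighborhood $\pi$-basis of $\tau$: a family $\mathcal{A}$ of subsets of $X$ (not necessarily open) such that for each nonempty $\tau$-open set $B$ there is $A\in\mathcal{A}$ with $\mathrm{int}_\tau(A)\neq\emptyset$ and $A\subseteq B$. $\kappa$-Baire: a set is $\kappa$-meager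 (with respect to $\tau$) if it is the union of $<\kappa$ many $\tau$-nowhere dense sets; $\tau$ is $\kappa$-Baire if the complement of each $\kappa$-meager set is $\tau$-dense. $\pi$-semiregular: a topology is $\pi$-semiregular if each nonempty open set contains a nonempty regular open set, i.e. a nonempty set equal to the interior of its closure. Borel classes (with respect to a given topology): for a cardinal $\nu>0$ (possibly finite) with cardinal successor $\nu^+$, let $\mathbf{S}^\nu_0$ be the family of all open sets and, for $0<\xi<\nu^+$, let $\mathbf{S}^\nu_\xi$ consist of unions of subfamilies of cardinality $\leq\nu$ of complements of sets in $\bigcup_{\gamma<\xi}\mathbf{S}^\nu_\gamma$. For an ordinal $\xi<\kappa$, $\mathbf{\Sigma}^{\kappa,0}_{1+\xi}=\bigcup\{\mathbf{S}^\nu_\xi\mid\nu\text{ a cardinal},\ \nu<\kappa,\ \xi<\nu^+\}$. "With respect to $\sigma$" means these are computed starting from the $\sigma$-open sets. *)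

theory Defs
  imports "HOL-Analysis.Analysis"
begin

unbundle cardinal_syntax

text \<open>
  Cardinals and ordinals are the well-orders of the BNF cardinal library. A cardinal is a
  relation \<open>\<kappa>\<close> with \<open>Card_order \<kappa>\<close>, that is, an initial ordinal; an ordinal \<open>\<rho>\<close> is a relation
  with \<open>Well_order \<rho>\<close>, and the ordinals \<open>\<xi> < \<rho>\<close> are represented by the elements \<open>\<xi>\<close> of \<open>Field \<rho>\<close>:
  such an element stands for the order type of the strict initial segment \<open>underS \<rho> \<xi>\<close>.
  In particular, \<open>\<xi>\<close> represents the ordinal 0 iff \<open>underS \<rho> \<xi> = {}\<close>.
\<close>

section \<open>Topologies on a fixed set\<close>

definition coarser_topology :: "'a topology \<Rightarrow> 'a topology \<Rightarrow> bool" (infix \<open>\<sqsubseteq>\<^sub>T\<close> 50) where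
  "\<sigma> \<sqsubseteq>\<^sub>T \<tau> \<longleftrightarrow> topspace \<sigma> = topspace \<tau> \<and> (\<forall>U. openin \<sigma> U \<longrightarrow> openin \<tau> U)"

definition join_topology :: "'a topology set \<Rightarrow> 'a topology" where
  "join_topology S = topology_generated_by (\<Union>T\<in>S. {U. openin T U})"

lemma openin_join_topology:
  assumes "T \<in> S" "openin T U"
  shows "openin (join_topology S) U"
  unfolding join_topology_def
  by (rule topology_generated_by_Basis) (use assms in blast)

lemma join_topology_least:
  assumes "\<And>T U. T \<in> S \<Longrightarrow> openin T U \<Longrightarrow> openin T' U" "openin (join_topology S) U"
  shows "openin T' U"
proof (rule generate_topology_on_coarsest)
  show "istopology (openin T')"
    by (rule istopology_openin)
  show "generate_topology_on (\<Union>T\<in>S. {U. openin T U}) U"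
    using assms(2) unfolding join_topology_def by (rule openin_topology_generated_by)
  show "openin T' V" if "V \<in> (\<Union>T\<in>S. {U. openin T U})" for V
    using that assms(1) by blast
qed

lemma topspace_join_topology:
  assumes "S \<noteq> {}" "\<And>T. T \<in> S \<Longrightarrow> topspace T = X"
  shows "topspace (join_topology S) = X"
proof -
  have "\<Union>(\<Union>T\<in>S. {U. openin T U}) = (\<Union>T\<in>S. topspace T)"
    unfolding topspace_def by blast
  also have "\<dots> = X"
    using assms by simp
  finally show ?thesis
    unfolding join_topology_def topology_generated_by_topspace .
qed

definition filtration ::
    "'i rel \<Rightarrow> ('i \<Rightarrow> 'a topology) \<Rightarrow> 'a topology \<Rightarrow> 'a topology \<Rightarrow> bool" where
  "filtration \<rho> t \<sigma> \<tau> \<longleftrightarrow>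
     Well_order \<rho> \<and> \<sigma> \<sqsubseteq>\<^sub>T \<tau> \<and>
     (\<forall>\<xi>\<in>Field \<rho>. underS \<rho> \<xi> = {} \<longrightarrow> t \<xi> = \<sigma>) \<and>
     (\<forall>\<xi> \<zeta>. (\<xi>, \<zeta>) \<in> \<rho> \<longrightarrow> t \<xi> \<sqsubseteq>\<^sub>T t \<zeta>) \<and>
     (\<forall>\<xi>\<in>Field \<rho>. t \<xi> \<sqsubseteq>\<^sub>T \<tau>) \<and>
     (\<forall>\<alpha>\<in>Field \<rho>. \<forall>\<xi>\<in>underS \<rho> \<alpha>. \<forall>F. closedin (t \<xi>) F \<longrightarrow>
        (t \<alpha>) interior_of F = \<tau> interior_of F)"

definition nbhd_pi_basis :: "'a topology \<Rightarrow> 'a set set \<Rightarrow> bool" where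
  "nbhd_pi_basis \<tau> \<A> \<longleftrightarrow>
     (\<forall>A\<in>\<A>. A \<subseteq> topspace \<tau>) \<and>
     (\<forall>B. openin \<tau> B \<and> B \<noteq> {} \<longrightarrow> (\<exists>A\<in>\<A>. \<tau> interior_of A \<noteq> {} \<and> A \<subseteq> B))"

definition nowhere_dense_in :: "'a topology \<Rightarrow> 'a set \<Rightarrow> bool" where
  "nowhere_dense_in \<tau> N \<longleftrightarrow> N \<subseteq> topspace \<tau> \<and> \<tau> interior_of (\<tau> closure_of N) = {}"

definition kappa_meager :: "'k rel \<Rightarrow> 'a topology \<Rightarrow> 'a set \<Rightarrow> bool" where
  "kappa_meager \<kappa> \<tau> M \<longleftrightarrow>
     (\<exists>\<N>. |\<N>| <o \<kappa> \<and> (\<forall>N\<in>\<N>. nowhere_dense_in \<tau> N) \<and> M = \<Union>\<N>)"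

definition kappa_Baire :: "'k rel \<Rightarrow> 'a topology \<Rightarrow> bool" where
  "kappa_Baire \<kappa> \<tau> \<longleftrightarrow>
     (\<forall>M. kappa_meager \<kappa> \<tau> M \<longrightarrow> \<tau> closure_of (topspace \<tau> - M) = topspace \<tau>)"

definition regular_open :: "'a topology \<Rightarrow> 'a set \<Rightarrow> bool" where
  "regular_open \<tau> V \<longleftrightarrow> V = \<tau> interior_of (\<tau> closure_of V)"

definition pi_semiregular :: "'a topology \<Rightarrow> bool" where
  "pi_semiregular \<tau> \<longleftrightarrow>
     (\<forall>U. openin \<tau> U \<and> U \<noteq> {} \<longrightarrow> (\<exists>V. V \<noteq> {} \<and> regular_open \<tau> V \<and> V \<subseteq> U))"

section \<open>Borel classes\<close>

definition S_step ::
    "'a topology \<Rightarrow> 'k rel \<Rightarrow> 'i rel \<Rightarrow> ('i \<Rightarrow> 'a set set) \<Rightarrow> 'i \<Rightarrow> 'a set set" where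
  "S_step T \<nu> \<rho> f \<xi> =
     (if underS \<rho> \<xi> = {} then {U. openin T U}
      else {\<Union>\<F> | \<F>. |\<F>| \<le>o \<nu> \<and> \<F> \<subseteq> (\<lambda>B. topspace T - B) ` (\<Union>\<gamma>\<in>underS \<rho> \<xi>. f \<gamma>)})"

text \<open>\<open>S_class T \<nu> \<rho> \<xi>\<close> is the class \<open>S\<^sup>\<nu>\<^sub>\<xi>\<close> with respect to \<open>T\<close>, for the ordinal represented by
  \<open>\<xi> \<in> Field \<rho>\<close>; it is defined by transfinite recursion along \<open>\<rho>\<close>.\<close>

definition S_class :: "'a topology \<Rightarrow> 'k rel \<Rightarrow> 'i rel \<Rightarrow> 'i \<Rightarrow> 'a set set" where
  "S_class T \<nu> \<rho> = wo_rel.worec \<rho> (S_step T \<nu> \<rho>)"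

lemma S_class_rec:
  assumes "Well_order \<rho>"
  shows "S_class T \<nu> \<rho> \<xi> =
     (if underS \<rho> \<xi> = {} then {U. openin T U}
      else {\<Union>\<F> | \<F>. |\<F>| \<le>o \<nu> \<and>
              \<F> \<subseteq> (\<lambda>B. topspace T - B) ` (\<Union>\<gamma>\<in>underS \<rho> \<xi>. S_class T \<nu> \<rho> \<gamma>)})"
proof -
  have wo: "wo_rel \<rho>"
    using assms by (simp add: wo_rel_def)
  have "S_step T \<nu> \<rho> f x = S_step T \<nu> \<rho> g x"
    if "\<forall>y\<in>underS \<rho> x. f y = g y" for f g x
    using that unfolding S_step_def by simp
  then have "wo_rel.adm_wo \<rho> (S_step T \<nu> \<rho>)"
    unfolding wo_rel.adm_wo_def[OF wo] by blast
  from wo_rel.worec_fixpoint[OF wo this] have "S_class T \<nu> \<rho> = S_step T \<nu> \<rho> (S_class T \<nu> \<rho>)"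
    unfolding S_class_def .
  then have "S_class T \<nu> \<rho> \<xi> = S_step T \<nu> \<rho> (S_class T \<nu> \<rho>) \<xi>"
    by (rule fun_cong)
  then show ?thesis
    unfolding S_step_def .
qed

text \<open>\<open>Sigma_class \<kappa> T \<rho> \<xi>\<close> is the class with lower index \<open>1 + \<xi>\<close>. The cardinals \<open>\<nu> < \<kappa>\<close> are
  taken on the carrier type of \<open>\<kappa>\<close>, which is no restriction: every cardinal below \<open>\<kappa>\<close> is
  isomorphic to one there. Finite nonzero \<open>\<nu>\<close> are included, and \<open>cardSuc\<close> is the least larger
  cardinal also for those. The relation \<open>Restr \<rho> (underS \<rho> \<xi>)\<close> is the ordinal represented by \<open>\<xi>\<close>.\<close>

definition Sigma_class :: "'k rel \<Rightarrow> 'a topology \<Rightarrow> 'i rel \<Rightarrow> 'i \<Rightarrow> 'a set set" where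
  "Sigma_class \<kappa> T \<rho> \<xi> =
     \<Union>{S_class T \<nu> \<rho> \<xi> | \<nu> :: 'k rel.
         Card_order \<nu> \<and> Field \<nu> \<noteq> {} \<and> \<nu> <o \<kappa> \<and> Restr \<rho> (underS \<rho> \<xi>) <o cardSuc \<nu>}"

end

theory Submission
  imports Defs
begin

text \<open>
  The idea is that the filtration turns Borel complexity into openness modulo meager sets: a set
  \<open>A\<close> of class \<open>S\<^sup>\<nu>\<^sub>\<xi>\<close> with respect to \<open>\<sigma>\<close> agrees with a \<open>t \<xi>\<close>-open set \<open>W\<close> outside few
  \<open>\<tau>\<close>-nowhere dense sets (\<open>S_class_agrees_with_open\<close>). This is the usual proof that Borel sets
  have the Baire property, with attention paid to the topology in which the approximating
  set is open. Only complements matter there. If \<open>B\<close> agrees with a \<open>t \<gamma>\<close>-open set \<open>W\<close>, then the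
  complement of \<open>B\<close> agrees with the \<open>t \<gamma>\<close>-closed set \<open>F\<close> complementary to \<open>W\<close>; up to its
  nowhere dense boundary, \<open>F\<close> is its \<open>\<tau>\<close>-interior, and the filtration condition says that this
  interior is already \<open>t \<xi>\<close>-open for every \<open>\<xi> > \<gamma>\<close>.

  Now let \<open>U\<close> be nonempty and \<open>\<tau>\<close>-open. Choose a nonempty regular open \<open>V \<subseteq> U\<close>, a member \<open>A \<subseteq> V\<close>
  of the neighborhood \<open>\<pi>\<close>-basis, and the \<open>t \<xi>\<close>-open \<open>W\<close> that agrees with \<open>A\<close>. In a \<open>\<kappa>\<close>-Baire
  space two consequences follow. The set \<open>W\<close> is nonempty, since otherwise the nonempty interior
  of \<open>A\<close> would be meager. And \<open>W\<close> cannot meet the complement of the closure of \<open>V\<close>, since there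
  it is disjoint from \<open>A\<close> and hence meager; so \<open>W\<close> is contained in the interior of the closure of
  \<open>V\<close>, which is \<open>V\<close>. Thus \<open>W\<close> is as required, and it is open in a single \<open>t \<xi>\<close>.
\<close>

section \<open>Small families\<close>

text \<open>
  The alternative of finiteness lets finite and infinite cardinals \<open>\<nu>\<close> be treated together:
  a union of at most \<open>\<nu>\<close> such families is again such a family, although \<open>\<nu> \<cdot> \<nu> = \<nu>\<close> fails for
  finite \<open>\<nu> > 1\<close>. The family still has fewer than \<open>\<kappa>\<close> members whenever \<open>\<nu> < \<kappa>\<close> and \<open>\<kappa>\<close> is
  infinite, also when \<open>\<kappa>\<close> is countable or singular.
\<close>

definition finite_or_card_le :: "'k rel \<Rightarrow> 'b set \<Rightarrow> bool" where
  "finite_or_card_le \<nu> N \<longleftrightarrow> finite N \<or> |N| \<le>o \<nu>"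

lemma finite_or_card_le_iff_finite:
  assumes "Card_order \<nu>" "finite (Field \<nu>)"
  shows "finite_or_card_le \<nu> N \<longleftrightarrow> finite N"
proof -
  have "finite N" if "|N| \<le>o \<nu>"
  proof -
    have "|N| \<le>o |Field \<nu>|"
      using that ordIso_symmetric[OF card_of_Field_ordIso[OF assms(1)]] by (rule ordLeq_ordIso_trans)
    then show ?thesis
      using assms(2) by (rule card_of_ordLeq_finite)
  qed
  then show ?thesis
    unfolding finite_or_card_le_def by blast
qed

lemma finite_card_less_infinite_Card_order:
  assumes "Card_order \<kappa>" "infinite (Field \<kappa>)" "finite N"
  shows "|N| <o \<kappa>"
  using assms card_of_Well_order[of N] card_order_on_well_order_on[OF assms(1)]
  by (intro finite_ordLess_infinite) (simp_all add: Field_card_of)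

lemma finite_or_card_le_iff_card_le:
  assumes "Card_order \<nu>" "infinite (Field \<nu>)"
  shows "finite_or_card_le \<nu> N \<longleftrightarrow> |N| \<le>o \<nu>"
proof -
  have "|N| \<le>o \<nu>" if "finite N"
    using finite_card_less_infinite_Card_order[OF assms that] by (rule ordLess_imp_ordLeq)
  then show ?thesis
    unfolding finite_or_card_le_def by blast
qed

lemma finite_or_card_le_UN:
  assumes "Card_order \<nu>" "finite_or_card_le \<nu> I" "\<And>i. i \<in> I \<Longrightarrow> finite_or_card_le \<nu> (N i)"
  shows "finite_or_card_le \<nu> (\<Union>i\<in>I. N i)"
proof (cases "finite (Field \<nu>)")
  case True
  then show ?thesis
    using assms by (simp add: finite_or_card_le_iff_finite)
next
  case False
  then show ?thesis
    using assms by (simp add: finite_or_card_le_iff_card_le card_of_UNION_ordLeq_infinite_Field)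
qed

lemma finite_or_card_le_insert:
  assumes "Card_order \<nu>" "finite_or_card_le \<nu> N"
  shows "finite_or_card_le \<nu> (insert x N)"
proof -
  have "finite_or_card_le \<nu> (\<Union>M\<in>{{x}, N}. M)"
  proof (rule finite_or_card_le_UN[OF assms(1)])
    show "finite_or_card_le \<nu> {{x}, N}"
      by (simp add: finite_or_card_le_def)
    show "finite_or_card_le \<nu> M" if "M \<in> {{x}, N}" for M
      using that assms(2) by (auto simp: finite_or_card_le_def)
  qed
  then show ?thesis
    by simp
qed

lemma finite_or_card_le_imp_card_less:
  assumes "Card_order \<kappa>" "infinite (Field \<kappa>)" "\<nu> <o \<kappa>" "finite_or_card_le \<nu> N"
  shows "|N| <o \<kappa>"
proof (cases "finite N")
  case True
  with assms(1,2) show ?thesis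
    by (rule finite_card_less_infinite_Card_order)
next
  case False
  then have "|N| \<le>o \<nu>"
    using assms(4) by (simp add: finite_or_card_le_def)
  then show ?thesis
    using assms(3) by (rule ordLeq_ordLess_trans)
qed

section \<open>Agreement modulo nowhere dense sets\<close>

definition agree_modulo ::
    "'k rel \<Rightarrow> 'a topology \<Rightarrow> 'a set \<Rightarrow> 'a set \<Rightarrow> bool" where
  "agree_modulo \<nu> \<tau> A W \<longleftrightarrow>
     (\<exists>\<N>. finite_or_card_le \<nu> \<N> \<and> (\<forall>N\<in>\<N>. nowhere_dense_in \<tau> N) \<and>
        A \<subseteq> W \<union> \<Union>\<N> \<and> W \<subseteq> A \<union> \<Union>\<N>)"

lemma agree_modulo_refl: "agree_modulo \<nu> \<tau> A A"
  unfolding agree_modulo_def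
  by (rule exI[of _ "{}"]) (simp add: finite_or_card_le_def)

lemma agree_modulo_UN:
  assumes "Card_order \<nu>" "|I| \<le>o \<nu>" "\<And>i. i \<in> I \<Longrightarrow> agree_modulo \<nu> \<tau> (A i) (W i)"
  shows "agree_modulo \<nu> \<tau> (\<Union>i\<in>I. A i) (\<Union>i\<in>I. W i)"
proof -
  have "\<forall>i\<in>I. \<exists>\<N>. finite_or_card_le \<nu> \<N> \<and> (\<forall>N\<in>\<N>. nowhere_dense_in \<tau> N) \<and>
      A i \<subseteq> W i \<union> \<Union>\<N> \<and> W i \<subseteq> A i \<union> \<Union>\<N>"
    using assms(3) unfolding agree_modulo_def by blast
  from bchoice[OF this] obtain \<N> where \<N>:
    "\<forall>i\<in>I. finite_or_card_le \<nu> (\<N> i) \<and> (\<forall>N\<in>\<N> i. nowhere_dense_in \<tau> N) \<and>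
      A i \<subseteq> W i \<union> \<Union>(\<N> i) \<and> W i \<subseteq> A i \<union> \<Union>(\<N> i)"
    by blast
  have "finite_or_card_le \<nu> (\<Union>i\<in>I. \<N> i)"
    using assms(1,2) \<N> by (intro finite_or_card_le_UN) (auto simp: finite_or_card_le_def)
  moreover have "\<forall>N\<in>(\<Union>i\<in>I. \<N> i). nowhere_dense_in \<tau> N"
    using \<N> by blast
  moreover have "A i \<subseteq> (\<Union>i\<in>I. W i) \<union> \<Union>(\<Union>i\<in>I. \<N> i)"
      "W i \<subseteq> (\<Union>i\<in>I. A i) \<union> \<Union>(\<Union>i\<in>I. \<N> i)" if "i \<in> I" for i
  proof -
    have "A i \<subseteq> W i \<union> \<Union>(\<N> i)" "W i \<subseteq> A i \<union> \<Union>(\<N> i)"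
      using \<N> that by simp_all
    moreover have "W i \<subseteq> (\<Union>i\<in>I. W i)" "A i \<subseteq> (\<Union>i\<in>I. A i)" "\<Union>(\<N> i) \<subseteq> \<Union>(\<Union>i\<in>I. \<N> i)"
      using that by (simp_all add: UN_upper Union_mono)
    ultimately show "A i \<subseteq> (\<Union>i\<in>I. W i) \<union> \<Union>(\<Union>i\<in>I. \<N> i)"
      "W i \<subseteq> (\<Union>i\<in>I. A i) \<union> \<Union>(\<Union>i\<in>I. \<N> i)"
      by (meson Un_mono order_trans)+
  qed
  ultimately show ?thesis
    unfolding agree_modulo_def
    by (intro exI[of _ "\<Union>i\<in>I. \<N> i"] conjI UN_least)
qed

lemma nowhere_dense_in_closed_minus_interior:
  assumes "closedin \<tau> F"
  shows "nowhere_dense_in \<tau> (F - \<tau> interior_of F)"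
proof -
  let ?N = "F - \<tau> interior_of F"
  have closed: "closedin \<tau> ?N"
    using assms by (simp add: closedin_diff)
  have "\<tau> interior_of ?N \<subseteq> \<tau> interior_of F"
    by (rule interior_of_mono) blast
  moreover have "\<tau> interior_of ?N \<subseteq> ?N"
    by (rule interior_of_subset)
  ultimately have "\<tau> interior_of ?N = {}"
    by blast
  then show ?thesis
    using closed closedin_subset[OF closed]
    unfolding nowhere_dense_in_def by (simp add: closure_of_closedin)
qed

lemma agree_modulo_complement:
  assumes "Card_order \<nu>" "openin \<tau> W" "agree_modulo \<nu> \<tau> B W"
  shows "agree_modulo \<nu> \<tau> (topspace \<tau> - B) (\<tau> interior_of (topspace \<tau> - W))"
proof -
  let ?F = "topspace \<tau> - W"
  let ?E = "?F - \<tau> interior_of ?F"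
  obtain \<N> where \<N>: "finite_or_card_le \<nu> \<N>" "\<forall>N\<in>\<N>. nowhere_dense_in \<tau> N"
      "B \<subseteq> W \<union> \<Union>\<N>" "W \<subseteq> B \<union> \<Union>\<N>"
    using assms(3) unfolding agree_modulo_def by blast
  have "nowhere_dense_in \<tau> ?E"
    using assms(2) by (intro nowhere_dense_in_closed_minus_interior) (simp add: closedin_diff)
  moreover have "finite_or_card_le \<nu> (insert ?E \<N>)"
    using assms(1) \<N>(1) by (rule finite_or_card_le_insert)
  moreover have "topspace \<tau> - B \<subseteq> \<tau> interior_of ?F \<union> \<Union>(insert ?E \<N>)"
    using \<N>(4) by auto
  moreover have "\<tau> interior_of ?F \<subseteq> (topspace \<tau> - B) \<union> \<Union>(insert ?E \<N>)"
    using \<N>(3) interior_of_subset[of \<tau> ?F] by auto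
  ultimately show ?thesis
    using \<N>(2) unfolding agree_modulo_def
    by (intro exI[of _ "insert ?E \<N>"] conjI) simp_all
qed

section \<open>Borel sets along a filtration\<close>

text \<open>
  The induction along the filtration works because the interior of a \<open>t \<gamma>\<close>-closed set is the same
  in \<open>\<tau>\<close> as in any later \<open>t \<xi>\<close>: nowhere density is measured in \<open>\<tau>\<close> throughout, while the
  approximating open set stays in \<open>t \<xi>\<close>. The exceptional family stays finite or of
  size at most \<open>\<nu>\<close> for every \<open>\<xi>\<close>, since each step collects at most \<open>\<nu>\<close> earlier families.
\<close>

lemma S_class_agrees_with_open:
  fixes \<nu> :: "'k rel"
  assumes "filtration \<rho> t \<sigma> \<tau>" "Card_order \<nu>" "\<xi> \<in> Field \<rho>" "A \<in> S_class \<sigma> \<nu> \<rho> \<xi>"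
  shows "\<exists>W. openin (t \<xi>) W \<and> agree_modulo \<nu> \<tau> A W"
proof -
  note filt = assms(1)[unfolded filtration_def]
  have wo: "Well_order \<rho>"
    using filt by (rule conjunct1)
  have \<sigma>: "topspace \<sigma> = topspace \<tau>"
    using filt[THEN conjunct2, THEN conjunct1] by (simp add: coarser_topology_def)
  have start: "t \<xi> = \<sigma>" if "\<xi> \<in> Field \<rho>" "underS \<rho> \<xi> = {}" for \<xi>
    using filt[THEN conjunct2, THEN conjunct2, THEN conjunct1] that by blast
  have coarser: "t \<xi> \<sqsubseteq>\<^sub>T \<tau>" if "\<xi> \<in> Field \<rho>" for \<xi>
    using filt that by (elim conjE) (rule bspec)
  have int: "(t \<xi>) interior_of F = \<tau> interior_of F"
    if "\<xi> \<in> Field \<rho>" "\<gamma> \<in> underS \<rho> \<xi>" "closedin (t \<gamma>) F" for \<gamma> \<xi> F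
    using filt[THEN conjunct2, THEN conjunct2, THEN conjunct2, THEN conjunct2, THEN conjunct2] that
    by blast
  have wo_rel: "wo_rel \<rho>"
    using wo by (simp add: wo_rel_def)
  have "\<xi> \<in> Field \<rho> \<longrightarrow>
      (\<forall>A\<in>S_class \<sigma> \<nu> \<rho> \<xi>. \<exists>W. openin (t \<xi>) W \<and> agree_modulo \<nu> \<tau> A W)"
  proof (rule wo_rel.well_order_induct[OF wo_rel, where a = \<xi>], intro impI ballI)
    fix \<xi> A
    assume IH: "\<forall>\<gamma>. \<gamma> \<noteq> \<xi> \<and> (\<gamma>, \<xi>) \<in> \<rho> \<longrightarrow> (\<gamma> \<in> Field \<rho> \<longrightarrow>
        (\<forall>A\<in>S_class \<sigma> \<nu> \<rho> \<gamma>. \<exists>W. openin (t \<gamma>) W \<and> agree_modulo \<nu> \<tau> A W))"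
      and \<xi>: "\<xi> \<in> Field \<rho>" and A: "A \<in> S_class \<sigma> \<nu> \<rho> \<xi>"
    show "\<exists>W. openin (t \<xi>) W \<and> agree_modulo \<nu> \<tau> A W"
    proof (cases "underS \<rho> \<xi> = {}")
      case True
      then have "openin (t \<xi>) A"
        using A start[OF \<xi>] S_class_rec[OF wo, of \<sigma> \<nu> \<xi>] by simp
      then show ?thesis
        using agree_modulo_refl by blast
    next
      case False
      then obtain \<F> where \<F>: "A = \<Union>\<F>" "|\<F>| \<le>o \<nu>"
          "\<F> \<subseteq> (\<lambda>B. topspace \<sigma> - B) ` (\<Union>\<gamma>\<in>underS \<rho> \<xi>. S_class \<sigma> \<nu> \<rho> \<gamma>)"
        using A S_class_rec[OF wo, of \<sigma> \<nu> \<xi>] by auto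
      have "\<exists>W. openin (t \<xi>) W \<and> agree_modulo \<nu> \<tau> C W" if C: "C \<in> \<F>" for C
      proof -
        obtain \<gamma> B where \<gamma>: "\<gamma> \<in> underS \<rho> \<xi>" and B: "B \<in> S_class \<sigma> \<nu> \<rho> \<gamma>"
          and C_eq: "C = topspace \<tau> - B"
          using C \<F>(3) \<sigma> by auto
        have \<gamma>_Field: "\<gamma> \<in> Field \<rho>"
          using \<gamma> by (auto simp: underS_def Field_def)
        obtain W where W: "openin (t \<gamma>) W" "agree_modulo \<nu> \<tau> B W"
          using IH \<gamma> \<gamma>_Field B unfolding underS_def by blast
        have "closedin (t \<gamma>) (topspace \<tau> - W)"
          using coarser[OF \<gamma>_Field] closedin_diff[OF closedin_topspace[of "t \<gamma>"] W(1)]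
          by (simp add: coarser_topology_def)
        then have "\<tau> interior_of (topspace \<tau> - W) = (t \<xi>) interior_of (topspace \<tau> - W)"
          using int[OF \<xi> \<gamma>] by simp
        then have "openin (t \<xi>) (\<tau> interior_of (topspace \<tau> - W))"
          by simp
        then show ?thesis
          using agree_modulo_complement[OF assms(2) _ W(2)] C_eq W(1) coarser[OF \<gamma>_Field]
          unfolding coarser_topology_def by blast
      qed
      then have "\<forall>C\<in>\<F>. \<exists>W. openin (t \<xi>) W \<and> agree_modulo \<nu> \<tau> C W"
        by blast
      from bchoice[OF this] obtain W where W:
        "\<forall>C\<in>\<F>. openin (t \<xi>) (W C) \<and> agree_modulo \<nu> \<tau> C (W C)"
        by blast
      have "agree_modulo \<nu> \<tau> (\<Union>C\<in>\<F>. C) (\<Union>C\<in>\<F>. W C)"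
        using assms(2) \<F>(2) W by (intro agree_modulo_UN) auto
      moreover have "openin (t \<xi>) (\<Union>C\<in>\<F>. W C)"
        using W by (intro openin_Union) auto
      ultimately show ?thesis
        using \<F>(1) by auto
    qed
  qed
  then show ?thesis
    using assms(3,4) by blast
qed

section \<open>From agreement to inclusion in Baire spaces\<close>

lemma kappa_Baire_open_subset_meager_empty:
  assumes "kappa_Baire \<kappa> \<tau>" "kappa_meager \<kappa> \<tau> M" "openin \<tau> U" "U \<subseteq> M"
  shows "U = {}"
proof -
  have "U \<inter> (topspace \<tau> - M) = {}"
    using assms(4) by blast
  then have "U \<inter> \<tau> closure_of (topspace \<tau> - M) = {}"
    using assms(3) by (simp add: openin_Int_closure_of_eq_empty)
  then show ?thesis
    using assms(1,2) openin_subset[OF assms(3)] unfolding kappa_Baire_def by auto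
qed

text \<open>
  Openness improves agreement modulo meager sets to inclusion: the part of \<open>W\<close> outside the closure
  of \<open>V\<close> is open, so in a \<open>\<kappa>\<close>-Baire space it is empty as soon as it is meager.
\<close>

lemma kappa_Baire_open_subset_regular_open:
  assumes "kappa_Baire \<kappa> \<tau>" "kappa_meager \<kappa> \<tau> M"
    and "openin \<tau> W" "regular_open \<tau> V" "V \<subseteq> topspace \<tau>" "W \<subseteq> V \<union> M"
  shows "W \<subseteq> V"
proof -
  have "W - \<tau> closure_of V \<subseteq> M"
    using assms(6) closure_of_subset[OF assms(5)] by blast
  moreover have "openin \<tau> (W - \<tau> closure_of V)"
    using assms(3) by (simp add: openin_diff)
  ultimately have "W - \<tau> closure_of V = {}"
    using kappa_Baire_open_subset_meager_empty[OF assms(1,2)] by blast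
  then have "W \<subseteq> \<tau> interior_of (\<tau> closure_of V)"
    using assms(3) by (intro interior_of_maximal) auto
  then show ?thesis
    using assms(4) unfolding regular_open_def by simp
qed

theorem theorem3p3:
  fixes X :: "'a set" and \<sigma> \<tau> :: "'a topology"
    and \<kappa> :: "'k rel" and \<alpha> :: "'i rel" and t :: "'i \<Rightarrow> 'a topology"
  assumes "topspace \<sigma> = X" and "topspace \<tau> = X" and "\<sigma> \<sqsubseteq>\<^sub>T \<tau>"
    and "pi_semiregular \<tau>"
    and "Card_order \<kappa>" and "infinite (Field \<kappa>)"
    and "kappa_Baire \<kappa> \<tau>"
    and "Well_order \<alpha>" and "Field \<alpha> \<noteq> {}" and "\<alpha> \<le>o \<kappa>"
    and "\<exists>\<A>. nbhd_pi_basis \<tau> \<A> \<and> \<A> \<subseteq> (\<Union>\<xi>\<in>Field \<alpha>. Sigma_class \<kappa> \<sigma> \<alpha> \<xi>)"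
    and "filtration \<alpha> t \<sigma> \<tau>"
  shows "\<forall>U. openin \<tau> U \<and> U \<noteq> {} \<longrightarrow>
           (\<exists>V. openin (join_topology (t ` Field \<alpha>)) V \<and> V \<noteq> {} \<and> V \<subseteq> U)"
proof (intro allI impI)
  fix U
  assume U: "openin \<tau> U \<and> U \<noteq> {}"
  obtain V where V: "V \<noteq> {}" "regular_open \<tau> V" "V \<subseteq> U"
    using assms(4) U unfolding pi_semiregular_def by blast
  have "openin \<tau> V"
    using V(2) unfolding regular_open_def by (metis openin_interior_of)
  obtain \<A> where \<A>: "nbhd_pi_basis \<tau> \<A>" "\<A> \<subseteq> (\<Union>\<xi>\<in>Field \<alpha>. Sigma_class \<kappa> \<sigma> \<alpha> \<xi>)"
    using assms(11) by blast
  obtain A where A: "A \<in> \<A>" "\<tau> interior_of A \<noteq> {}" "A \<subseteq> V"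
    using \<A>(1) \<open>openin \<tau> V\<close> V(1) unfolding nbhd_pi_basis_def by blast
  obtain \<xi> and \<nu> :: "'k rel" where \<xi>: "\<xi> \<in> Field \<alpha>"
    and \<nu>: "Card_order \<nu>" "\<nu> <o \<kappa>" "A \<in> S_class \<sigma> \<nu> \<alpha> \<xi>"
    using A(1) \<A>(2) unfolding Sigma_class_def by blast
  obtain W where W: "openin (t \<xi>) W" "agree_modulo \<nu> \<tau> A W"
    using S_class_agrees_with_open[OF assms(12) \<nu>(1) \<xi> \<nu>(3)] by blast
  have "openin \<tau> W"
    using assms(12) \<xi> W(1) unfolding filtration_def coarser_topology_def by blast
  obtain \<N> where \<N>: "finite_or_card_le \<nu> \<N>" "\<forall>N\<in>\<N>. nowhere_dense_in \<tau> N"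
      "A \<subseteq> W \<union> \<Union>\<N>" "W \<subseteq> A \<union> \<Union>\<N>"
    using W(2) unfolding agree_modulo_def by blast
  have "|\<N>| <o \<kappa>"
    using assms(5,6) \<nu>(2) \<N>(1) by (rule finite_or_card_le_imp_card_less)
  then have meager: "kappa_meager \<kappa> \<tau> (\<Union>\<N>)"
    using \<N>(2) unfolding kappa_meager_def by blast
  have "W \<subseteq> V"
    using A(3) \<N>(4)
    by (intro kappa_Baire_open_subset_regular_open[OF assms(7) meager \<open>openin \<tau> W\<close> V(2)
          openin_subset[OF \<open>openin \<tau> V\<close>]]) blast
  moreover have "W \<noteq> {}"
  proof
    assume "W = {}"
    then have "\<tau> interior_of A \<subseteq> \<Union>\<N>"
      using \<N>(3) interior_of_subset[of \<tau> A] by blast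
    then show False
      using kappa_Baire_open_subset_meager_empty[OF assms(7) meager openin_interior_of] A(2)
      by blast
  qed
  moreover have "openin (join_topology (t ` Field \<alpha>)) W"
    using \<xi> W(1) by (intro openin_join_topology[of "t \<xi>"]) auto
  ultimately show "\<exists>V. openin (join_topology (t ` Field \<alpha>)) V \<and> V \<noteq> {} \<and> V \<subseteq> U"
    using V(3) by blast
qed

end
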